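(* Let $\lambda/\mu$ be a skew shape with $\ell$ rows, let $\mathbf{a}=(a_1,\dots,a_\ell)$ and $\mathbf{b}=(b_1,\dots,b_\ell)$ be flags, let $\nu$ be a weight (a finite sequence of non-negative integers), and let $k\ge1$ be an integer. Then $$K_{k\lambda/k\mu,\,k\nu}(\mathbf{a},\mathbf{b})>0\ \Longrightarrow\ K_{\lambda/\mu,\,\nu}(\mathbf{a},\mathbf{b})>0 .$$
   Context: A flag is a weakly increasing list of non-negative integers. For a skew shape $\lambda/\mu$ with $\ell$ rows and flags $\mathbf{a},\mathbf{b}$ of length $\ell$, $\mathrm{SSYT}(\lambda/\mu,\mathbf{a},\mathbf{b})$ is the set of semistandard Young tableaux $T$ of shape $\lambda/\mu$ (positive integer entries, weakly increasing along rows, strictly increasing along columns as the row index increases) such that all entries in row $j$ belong to $\{a_j,a_j+1,\dots,b_j\}$ for each $j$. The flagged skew Kostka coefficient $K_{\lambda/\mu,\nu}(\mathbf{a},\mathbf{b})$ is the number of $T\in\mathrm{SSYT}(\lambda/\mu,\mathbf{a},\mathbf{b})$ of weight $\nu$, i.e. having exactly $\nu_i$ entries equal to $i$ for each $i$ (with $\nu_i=0$ beyond the length of $\nu$). For a sequence $\lambda$, $k\lambda$ denotes $(k\lambda_1,k\lambda_2,\dots)$. *)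

theory Defs
  imports "HOL-Library.FuncSet"
begin

text \<open>
  Rows and columns are numbered from 0, whereas the entries of a tableau are honest positive
  integers.  A skew shape with \<open>l\<close> rows is a pair of weakly decreasing lists of
  length \<open>l\<close>, the inner one padded with zeros; rows are allowed to be empty.
\<close>

definition skew_shape :: "nat list \<Rightarrow> nat list \<Rightarrow> bool" where
  "skew_shape lam mu \<longleftrightarrow>
     length mu = length lam \<and> sorted_wrt (\<ge>) lam \<and> sorted_wrt (\<ge>) mu \<and>
     (\<forall>i < length lam. mu ! i \<le> lam ! i)"

definition cells :: "nat list \<Rightarrow> nat list \<Rightarrow> (nat \<times> nat) set" where
  "cells lam mu = {(i, j). i < length lam \<and> mu ! i \<le> j \<and> j < lam ! i}"

text \<open>
  A tableau is a function on cells, extended by \<open>undefined\<close> outside the shape so that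
  distinct tableaux are distinct functions.
\<close>

definition ssyt :: "nat list \<Rightarrow> nat list \<Rightarrow> (nat \<times> nat \<Rightarrow> nat) set" where
  "ssyt lam mu = {T. T \<in> extensional (cells lam mu) \<and>
     (\<forall>c \<in> cells lam mu. T c > 0) \<and>
     (\<forall>i j j'. (i, j) \<in> cells lam mu \<longrightarrow> (i, j') \<in> cells lam mu \<longrightarrow> j < j' \<longrightarrow>
        T (i, j) \<le> T (i, j')) \<and>
     (\<forall>i i' j. (i, j) \<in> cells lam mu \<longrightarrow> (i', j) \<in> cells lam mu \<longrightarrow> i < i' \<longrightarrow>
        T (i, j) < T (i', j))}"

definition flagged_ssyt ::
  "nat list \<Rightarrow> nat list \<Rightarrow> nat list \<Rightarrow> nat list \<Rightarrow> (nat \<times> nat \<Rightarrow> nat) set" where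
  "flagged_ssyt lam mu a b =
     {T \<in> ssyt lam mu. \<forall>(i, j) \<in> cells lam mu. T (i, j) \<in> {a ! i..b ! i}}"

text \<open>The list entry \<open>nu ! (i - 1)\<close> is the prescribed number of entries equal to \<open>i\<close>.\<close>

definition has_weight ::
  "nat list \<Rightarrow> nat list \<Rightarrow> (nat \<times> nat \<Rightarrow> nat) \<Rightarrow> nat list \<Rightarrow> bool" where
  "has_weight lam mu T nu \<longleftrightarrow>
     (\<forall>i \<ge> 1. card {c \<in> cells lam mu. T c = i} = (if i \<le> length nu then nu ! (i - 1) else 0))"

definition flagged_kostka ::
  "nat list \<Rightarrow> nat list \<Rightarrow> nat list \<Rightarrow> nat list \<Rightarrow> nat list \<Rightarrow> nat" where
  "flagged_kostka lam mu nu a b = card {T \<in> flagged_ssyt lam mu a b. has_weight lam mu T nu}"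

definition scale :: "nat \<Rightarrow> nat list \<Rightarrow> nat list" where
  "scale k xs = map (\<lambda>x. k * x) xs"

lemma finite_cells: "finite (cells lam mu)"
proof -
  have "cells lam mu = Sigma {..<length lam} (\<lambda>i. {mu ! i..<lam ! i})"
    by (auto simp: cells_def)
  then show ?thesis by simp
qed

text \<open>The cardinality defining \<open>flagged_kostka\<close> is thus a genuine count.\<close>

lemma finite_flagged_ssyt: "finite (flagged_ssyt lam mu a b)"
proof (rule finite_subset)
  show "flagged_ssyt lam mu a b \<subseteq> PiE (cells lam mu) (\<lambda>c. {a ! fst c..b ! fst c})"
    by (simp add: flagged_ssyt_def ssyt_def PiE_iff subset_iff split_beta)
  show "finite (PiE (cells lam mu) (\<lambda>c. {a ! fst c..b ! fst c}))"
    by (simp add: finite_PiE finite_cells)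
qed

end

theory Submission
  imports Defs "HOL-Library.Multiset"
begin

text \<open>
  Positivity of the coefficient can be decided without looking at the order of the entries.  Call
  a filling of \<open>\<lambda>/\<mu>\<close> admissible if it respects the flags and has no repeated entry in any
  column.  A flagged tableau is admissible, and conversely an admissible filling can be sorted
  into a flagged tableau of the same weight: sorting each column keeps the flags because they
  increase (\<open>column_strict_flagged_filling\<close>), and sorting each row afterwards keeps the columns
  strict, for skew shapes as well (\<open>sort_rows_of_column_strict_filling\<close>).
  
  Admissible fillings of weight \<open>\<nu>\<close> are the integral flows in a network: every cell sends one
  unit to a slot (column, value), where the value must be allowed for the cell; a slot passes at
  most one unit on to its value; the value \<open>v\<close> absorbs \<open>\<nu>\<^sub>v\<close> units.  The shape
  \<open>k\<lambda>/k\<mu>\<close> consists of \<open>k\<close> copies of each column of \<open>\<lambda>/\<mu>\<close>, so a tableau of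
  weight \<open>k\<nu>\<close> on it, averaged over the copies, is a fractional flow in the network of
  \<open>\<lambda>/\<mu>\<close>.  All capacities and demands are integers, hence an integral flow exists as well
  (\<open>integral_flow\<close>, used through \<open>round_fractional_filling\<close>).
\<close>

section \<open>Integral flows\<close>

text \<open>
  Flows are antisymmetric, with negative values for flow in the opposite direction.  An arc has
  room for another unit if \<open>g u v < cap u v\<close>; this covers both adding flow and
  cancelling flow from \<open>v\<close> to \<open>u\<close>, so the residual
  network is simply the relation \<open>g u v < cap u v\<close>.
\<close>

definition flow :: "('n \<Rightarrow> 'n \<Rightarrow> int) \<Rightarrow> ('n \<Rightarrow> 'n \<Rightarrow> int) \<Rightarrow> bool" where
  "flow cap g \<longleftrightarrow> (\<forall>u v. g u v = - g v u \<and> g u v \<le> cap u v)"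

definition outflow :: "'n set \<Rightarrow> ('n \<Rightarrow> 'n \<Rightarrow> int) \<Rightarrow> 'n \<Rightarrow> int" where
  "outflow N g u = (\<Sum>v\<in>N. g u v)"

lemma flow_antisym: "flow cap g \<Longrightarrow> g u v = - g v u"
  unfolding flow_def by blast

lemma flow_le_cap: "flow cap g \<Longrightarrow> g u v \<le> cap u v"
  unfolding flow_def by blast

lemma sum_antisym_eq_0:
  fixes g :: "'n \<Rightarrow> 'n \<Rightarrow> int"
  assumes "\<And>u v. g u v = - g v u"
  shows "(\<Sum>u\<in>A. \<Sum>v\<in>A. g u v) = 0"
proof -
  have "(\<Sum>u\<in>A. \<Sum>v\<in>A. g u v) = (\<Sum>v\<in>A. \<Sum>u\<in>A. g u v)"
    by (rule sum.swap)
  also have "\<dots> = (\<Sum>v\<in>A. \<Sum>u\<in>A. - g v u)"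
    using assms by (intro sum.cong refl) blast
  also have "\<dots> = - (\<Sum>v\<in>A. \<Sum>u\<in>A. g v u)"
    by (simp add: sum_negf)
  finally show ?thesis by simp
qed

text \<open>
  Flow inside \<open>R\<close> cancels, so only the arcs leaving \<open>R\<close> contribute.
\<close>

lemma sum_outflow_cut:
  assumes "\<And>u v. g u v = - g v u" "finite N" "R \<subseteq> N"
  shows "(\<Sum>u\<in>R. outflow N g u) = (\<Sum>u\<in>R. \<Sum>v\<in>N - R. g u v)"
proof -
  have "outflow N g u = (\<Sum>v\<in>N - R. g u v) + (\<Sum>v\<in>R. g u v)" for u
    unfolding outflow_def using assms by (intro sum.subset_diff) auto
  then show ?thesis
    using sum_antisym_eq_0[of g R, OF assms(1)] by (simp add: sum.distrib)
qed

text \<open>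
  The unit is pushed one arc at a time.  Since the path is simple, pushing along its first arc does
  not change the room on the later ones.
\<close>

lemma augment_along_path:
  assumes N: "finite N" and "set p \<subseteq> N" "distinct p" "p \<noteq> []"
    and "flow cap g" "successively (\<lambda>u v. g u v < cap u v) p"
  shows "\<exists>g'. flow cap g' \<and>
    (\<forall>u\<in>N. outflow N g' u = outflow N g u + of_bool (u = hd p) - of_bool (u = last p))"
  using assms(2-)
proof (induction p arbitrary: g rule: induct_list012)
  case 1
  then show ?case by simp
next
  case (2 x)
  then show ?case by auto
next
  case (3 s x p)
  define h where "h u v = g u v + of_bool (u = s \<and> v = x) - of_bool (v = s \<and> u = x)" for u v
  have sx: "s \<noteq> x" "g s x < cap s x" "s \<in> N" "x \<in> N" "s \<notin> set (x # p)"
    using 3 by auto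
  have fl: "g u v = - g v u" "g u v \<le> cap u v" for u v
    using flow_antisym[OF "3.prems"(4)] flow_le_cap[OF "3.prems"(4)] by blast+
  have "h u v = - h v u" for u v
    unfolding h_def using fl(1)[of u v] by linarith
  moreover have "h u v \<le> cap u v" for u v
    unfolding h_def using fl(2)[of u v] sx by (auto simp: of_bool_def)
  ultimately have "flow cap h"
    unfolding flow_def by blast
  moreover have "successively (\<lambda>u v. h u v < cap u v) (x # p)"
  proof -
    have "successively (\<lambda>u v. g u v < cap u v) (x # p)"
      using 3 by simp
    then show ?thesis
      by (rule successively_mono) (use sx(5) in \<open>auto simp: h_def\<close>)
  qed
  ultimately obtain g' where g': "flow cap g'"
    "\<forall>u\<in>N. outflow N g' u = outflow N h u + of_bool (u = x) - of_bool (u = last (x # p))"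
    using "3.IH"(2)[of h] "3.prems" by auto
  have "outflow N h u = outflow N g u + of_bool (u = s) - of_bool (u = x)" if "u \<in> N" for u
  proof -
    have "(\<Sum>v\<in>N. of_bool (u = s \<and> v = x)) = (of_bool (u = s) :: int)"
      using sx(4) N by (cases "u = s") (auto simp: of_bool_def)
    moreover have "(\<Sum>v\<in>N. of_bool (v = s \<and> u = x)) = (of_bool (u = x) :: int)"
      using sx(3) N by (cases "u = x") (auto simp: of_bool_def)
    ultimately show ?thesis
      by (simp only: outflow_def h_def sum.distrib sum_subtractf)
  qed
  with g' show ?case
    by (intro exI[of _ g']) simp
qed

text \<open>
  The cut argument of the max-flow min-cut theorem.  If no node with too much outflow could be
  reached from \<open>s\<close>, the set \<open>R\<close> of reachable nodes would send out less than the
  demands \<open>d\<close> in total, although every arc leaving \<open>R\<close> is saturated; but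
  \<open>G / k\<close> meets the demands under the same capacities.
\<close>

lemma improve_flow:
  fixes cap G :: "'n \<Rightarrow> 'n \<Rightarrow> int" and d :: "'n \<Rightarrow> int" and k :: int
  assumes N: "finite N" and k: "k > 0"
    and G: "\<And>u v. G u v = - G v u" "\<And>u v. u \<in> N \<Longrightarrow> v \<in> N \<Longrightarrow> G u v \<le> k * cap u v"
      "\<And>u. u \<in> N \<Longrightarrow> outflow N G u = k * d u"
    and g: "flow cap g" and s: "s \<in> N" "outflow N g s < d s"
  shows "\<exists>g' t. flow cap g' \<and> t \<in> N \<and> d t < outflow N g t \<and>
    (\<forall>u\<in>N. outflow N g' u = outflow N g u + of_bool (u = s) - of_bool (u = t))"
proof -
  define paths where "paths = {p. p \<noteq> [] \<and> hd p = s \<and> distinct p \<and> set p \<subseteq> N \<and>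
    successively (\<lambda>u v. g u v < cap u v) p}"
  define R where "R = last ` paths"
  have fl: "g u v = - g v u" "g u v \<le> cap u v" for u v
    using flow_antisym[OF g] flow_le_cap[OF g] by blast+
  have "\<exists>t\<in>R. d t < outflow N g t"
  proof (rule ccontr)
    assume "\<not> ?thesis"
    then have ge: "outflow N g t \<le> d t" if "t \<in> R" for t
      using that by force
    have "R \<subseteq> N"
      unfolding R_def paths_def by auto
    then have "finite R"
      using N finite_subset by blast
    have "[s] \<in> paths"
      using s by (simp add: paths_def)
    then have "s \<in> R"
      unfolding R_def by force
    have saturated: "g u v = cap u v" if uv: "u \<in> R" "v \<in> N - R" for u v
    proof (rule ccontr)
      assume "g u v \<noteq> cap u v"
      then have res: "g u v < cap u v"
        using fl(2)[of u v] by simp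
      obtain p where p: "p \<in> paths" "last p = u"
        using uv unfolding R_def by blast
      show False
      proof (cases "v \<in> set p")
        case True
        then obtain xs ys where "p = (xs @ [v]) @ ys"
          by (metis append.assoc append_Cons append_Nil split_list)
        moreover from this have "hd p = hd (xs @ [v])"
          by (cases xs) auto
        ultimately have "xs @ [v] \<in> paths"
          using p(1) unfolding paths_def successively_append_iff
          by (auto simp: successively_append_iff)
        then show False
          using uv unfolding R_def by force
      next
        case False
        with p uv res have "p @ [v] \<in> paths"
          unfolding paths_def by (auto simp: successively_append_iff)
        then show False
          using uv unfolding R_def by force
      qed
    qed
    \<comment> \<open>Compare \<open>k\<close> times the outflow of \<open>R\<close> under \<open>g\<close> with its outflow under \<open>G\<close>.\<close>
    have "k * (\<Sum>u\<in>R. outflow N g u) < k * (\<Sum>u\<in>R. d u)"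
      using k sum_strict_mono_ex1[OF \<open>finite R\<close>, of "outflow N g" d] ge s \<open>s \<in> R\<close> by auto
    also have "\<dots> = (\<Sum>u\<in>R. outflow N G u)"
      using G(3) \<open>R \<subseteq> N\<close> by (simp add: sum_distrib_left subset_iff)
    also have "\<dots> = (\<Sum>u\<in>R. \<Sum>v\<in>N - R. G u v)"
      by (rule sum_outflow_cut[of G, OF G(1) N \<open>R \<subseteq> N\<close>])
    also have "\<dots> \<le> (\<Sum>u\<in>R. \<Sum>v\<in>N - R. k * cap u v)"
      using \<open>R \<subseteq> N\<close> by (intro sum_mono G(2)) auto
    also have "\<dots> = k * (\<Sum>u\<in>R. \<Sum>v\<in>N - R. g u v)"
      using saturated by (simp add: sum_distrib_left)
    also have "\<dots> = k * (\<Sum>u\<in>R. outflow N g u)"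
      using sum_outflow_cut[of g, OF fl(1) N \<open>R \<subseteq> N\<close>] by simp
    finally show False by simp
  qed
  then obtain p where "p \<in> paths" "d (last p) < outflow N g (last p)"
    unfolding R_def by blast
  moreover from this have "last p \<in> N"
    unfolding paths_def by auto
  ultimately show ?thesis
    using augment_along_path[OF N, of p cap g] g unfolding paths_def by blast
qed

text \<open>
  Integrality of flows: \<open>G / k\<close> is a fractional flow with the integral outflows \<open>d\<close>.
  Starting from the zero flow, each improvement moves one unit from a node with too much
  outflow to one with too little and so lowers the total defect.
\<close>

theorem integral_flow:
  fixes cap G :: "'n \<Rightarrow> 'n \<Rightarrow> int" and d :: "'n \<Rightarrow> int" and k :: int
  assumes N: "finite N" and k: "k > 0" and cap: "\<And>u v. 0 \<le> cap u v"
    and G: "\<And>u v. G u v = - G v u" "\<And>u v. u \<in> N \<Longrightarrow> v \<in> N \<Longrightarrow> G u v \<le> k * cap u v"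
      "\<And>u. u \<in> N \<Longrightarrow> outflow N G u = k * d u"
  shows "\<exists>g. flow cap g \<and> (\<forall>u\<in>N. outflow N g u = d u)"
proof -
  define defect where "defect g = (\<Sum>u\<in>N. \<bar>d u - outflow N g u\<bar>)" for g
  have sum_d: "(\<Sum>u\<in>N. d u) = 0"
  proof -
    have "k * (\<Sum>u\<in>N. d u) = (\<Sum>u\<in>N. outflow N G u)"
      using G(3) by (simp add: sum_distrib_left)
    also have "\<dots> = 0"
      using sum_antisym_eq_0[of G N, OF G(1)] by (simp add: outflow_def)
    finally show ?thesis using k by simp
  qed
  have "\<exists>g'. flow cap g' \<and> (\<forall>u\<in>N. outflow N g' u = d u)" if "flow cap g" for g
    using that
  proof (induction "nat (defect g)" arbitrary: g rule: less_induct)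
    case less
    show ?case
    proof (cases "\<forall>u\<in>N. d u \<le> outflow N g u")
      case True
      have "(\<Sum>u\<in>N. outflow N g u - d u) = 0"
        using sum_antisym_eq_0[of g N, OF flow_antisym[OF less.prems]] sum_d
        by (simp add: outflow_def sum_subtractf)
      then have "\<forall>u\<in>N. outflow N g u - d u = 0"
        using True N by (subst (asm) sum_nonneg_eq_0_iff) auto
      then show ?thesis
        using less.prems by auto
    next
      case False
      then obtain s where s: "s \<in> N" "outflow N g s < d s"
        by force
      then obtain g' t where g': "flow cap g'" and t: "t \<in> N" "d t < outflow N g t"
        and out: "\<forall>u\<in>N. outflow N g' u = outflow N g u + of_bool (u = s) - of_bool (u = t)"
        using improve_flow[OF N k G less.prems s] by blast
      have "defect g' < defect g"
        unfolding defect_def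
      proof (rule sum_strict_mono_ex1[OF N])
        show "\<forall>u\<in>N. \<bar>d u - outflow N g' u\<bar> \<le> \<bar>d u - outflow N g u\<bar>"
          using out s t by (auto simp: of_bool_def)
        show "\<exists>u\<in>N. \<bar>d u - outflow N g' u\<bar> < \<bar>d u - outflow N g u\<bar>"
          using out s t by (intro bexI[of _ s]) (auto simp: of_bool_def)
      qed
      moreover have "0 \<le> defect g'"
        unfolding defect_def by (intro sum_nonneg) simp
      ultimately show ?thesis
        using less.hyps[of g'] g' by simp
    qed
  qed
  moreover have "flow cap (\<lambda>u v. 0)"
    using cap by (simp add: flow_def)
  ultimately show ?thesis by blast
qed

section \<open>Rounding a fractional filling\<close>

datatype ('c, 'j, 'v) node = Cell 'c | Slot 'j 'v | Val 'v

text \<open>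
  The values of \<open>x\<close> on the arcs from cells to slots and of \<open>y\<close> on the arcs from slots to
  values, as one function on pairs of nodes.  Both capacities and flows have this form, where
  \<open>q\<close> gives the column of a cell.
\<close>

fun arcs :: "('c \<Rightarrow> 'j) \<Rightarrow> ('c \<Rightarrow> 'v \<Rightarrow> int) \<Rightarrow> ('j \<Rightarrow> 'v \<Rightarrow> int) \<Rightarrow>
    ('c, 'j, 'v) node \<Rightarrow> ('c, 'j, 'v) node \<Rightarrow> int" where
  "arcs q x y (Cell c) (Slot j v) = (if j = q c then x c v else 0)"
| "arcs q x y (Slot j v) (Val w) = (if w = v then y j v else 0)"
| "arcs q x y _ _ = 0"

lemma arcs_nonneg:
  assumes "\<And>c v. 0 \<le> x c v" "\<And>j v. 0 \<le> y j v"
  shows "0 \<le> arcs q x y u v"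
  using assms by (cases u; cases v) auto

definition nodes :: "('c \<Rightarrow> 'j) \<Rightarrow> 'c set \<Rightarrow> 'v set \<Rightarrow> ('c, 'j, 'v) node set" where
  "nodes q C V = Cell ` C \<union> (\<Union>j\<in>q ` C. Slot j ` V) \<union> Val ` V"

lemma finite_nodes: "finite C \<Longrightarrow> finite V \<Longrightarrow> finite (nodes q C V)"
  by (simp add: nodes_def)

lemma sum_nodes:
  fixes f :: "('c, 'j, 'v) node \<Rightarrow> int"
  assumes "finite C" "finite V"
  shows "sum f (nodes q C V) =
    (\<Sum>c\<in>C. f (Cell c)) + (\<Sum>j\<in>q ` C. \<Sum>v\<in>V. f (Slot j v)) + (\<Sum>v\<in>V. f (Val v))"
proof -
  have "sum f (nodes q C V) =
      sum f (Cell ` C) + sum f (\<Union>j\<in>q ` C. Slot j ` V) + sum f (Val ` V)"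
  proof -
    have "(Cell ` C \<union> (\<Union>j\<in>q ` C. Slot j ` V)) \<inter> Val ` V = {}"
      "Cell ` C \<inter> (\<Union>j\<in>q ` C. Slot j ` V) = {}"
      by auto
    then show ?thesis
      unfolding nodes_def using assms by (simp add: sum.union_disjoint)
  qed
  moreover have "sum f (\<Union>j\<in>q ` C. Slot j ` V) = (\<Sum>j\<in>q ` C. sum f (Slot j ` V))"
    using assms by (intro sum.UNION_disjoint) auto
  ultimately show ?thesis
    by (simp add: sum.reindex inj_on_def)
qed

text \<open>
  Demanding outflow zero at a slot thus makes \<open>y j v\<close> the total use of \<open>v\<close> in the column \<open>j\<close>,
  and a bound on \<open>y j v\<close> a bound on the repetitions of \<open>v\<close> there.
\<close>

lemma outflow_nodes:
  fixes g :: "('c, 'j, 'v) node \<Rightarrow> ('c, 'j, 'v) node \<Rightarrow> int"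
  assumes fin: "finite C" "finite V"
    and g: "\<And>u v. g u v = arcs q x y u v - arcs q x y v u"
  shows "c \<in> C \<Longrightarrow> outflow (nodes q C V) g (Cell c) = (\<Sum>v\<in>V. x c v)"
    and "j \<in> q ` C \<Longrightarrow> v \<in> V \<Longrightarrow>
      outflow (nodes q C V) g (Slot j v) = y j v - (\<Sum>c\<in>{c \<in> C. q c = j}. x c v)"
    and "v \<in> V \<Longrightarrow> outflow (nodes q C V) g (Val v) = - (\<Sum>j\<in>q ` C. y j v)"
proof -
  show "outflow (nodes q C V) g (Cell c) = (\<Sum>v\<in>V. x c v)" if "c \<in> C"
  proof -
    have "outflow (nodes q C V) g (Cell c) = (\<Sum>j\<in>q ` C. \<Sum>v\<in>V. if j = q c then x c v else 0)"
      by (simp add: outflow_def sum_nodes[OF fin] g)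
    also have "\<dots> = (\<Sum>j\<in>q ` C. if j = q c then (\<Sum>v\<in>V. x c v) else 0)"
      by (intro sum.cong refl) simp
    finally show ?thesis
      using that fin by simp
  qed
  show "outflow (nodes q C V) g (Slot j v) = y j v - (\<Sum>c\<in>{c \<in> C. q c = j}. x c v)"
    if "j \<in> q ` C" "v \<in> V"
    using that fin
    by (simp add: outflow_def sum_nodes[OF fin] g sum_negf sum.inter_filter eq_commute[of j])
  show "outflow (nodes q C V) g (Val v) = - (\<Sum>j\<in>q ` C. y j v)" if "v \<in> V"
    using that fin by (simp add: outflow_def sum_nodes[OF fin] g sum_negf)
qed

text \<open>
  The numbers \<open>X c v / k\<close> describe a fractional filling of the cells \<open>C\<close>: each cell holds one
  unit, no value exceeds one unit in a column (a fibre of \<open>q\<close>), and \<open>v\<close> has total \<open>n v\<close>.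
  It is rounded to a genuine filling that uses only the values occurring in it.
\<close>

theorem round_fractional_filling:
  fixes X :: "'c \<Rightarrow> 'v \<Rightarrow> nat" and q :: "'c \<Rightarrow> 'j" and n :: "'v \<Rightarrow> nat"
  assumes fin: "finite C" "finite V" and k: "k > 0"
    and row: "\<And>c. c \<in> C \<Longrightarrow> (\<Sum>v\<in>V. X c v) = k"
    and col: "\<And>j v. v \<in> V \<Longrightarrow> (\<Sum>c\<in>{c \<in> C. q c = j}. X c v) \<le> k"
    and wt: "\<And>v. v \<in> V \<Longrightarrow> (\<Sum>c\<in>C. X c v) = k * n v"
  shows "\<exists>f. (\<forall>c\<in>C. f c \<in> V \<and> X c (f c) > 0) \<and>
    (\<forall>c\<in>C. \<forall>c'\<in>C. q c = q c' \<longrightarrow> f c = f c' \<longrightarrow> c = c') \<and>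
    (\<forall>v\<in>V. card {c \<in> C. f c = v} = n v)"
proof -
  let ?N = "nodes q C V"
  define Y where "Y j v = (\<Sum>c\<in>{c \<in> C. q c = j}. X c v)" for j v
  define A where "A = arcs q (\<lambda>c v. int (X c v)) (\<lambda>j v. int (Y j v))"
  define cap :: "('c, 'j, 'v) node \<Rightarrow> ('c, 'j, 'v) node \<Rightarrow> int" where
    "cap = arcs q (\<lambda>c v. of_bool (X c v > 0)) (\<lambda>j v. 1)"
  define d :: "('c, 'j, 'v) node \<Rightarrow> int" where
    "d u = (case u of Cell c \<Rightarrow> 1 | Slot j v \<Rightarrow> 0 | Val v \<Rightarrow> - int (n v))" for u
  have cap0: "0 \<le> cap u v" for u v
    unfolding cap_def by (intro arcs_nonneg) auto
  have A0: "0 \<le> A u v" for u v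
    unfolding A_def by (intro arcs_nonneg) auto
  have Xk: "X c v \<le> k" if "c \<in> C" "v \<in> V" for c v
    using member_le_sum[of v V "X c"] that fin row[of c] by simp
  have A_cap: "A u v \<le> int k * cap u v" if "u \<in> ?N" "v \<in> ?N" for u v
    using that Xk col k unfolding A_def cap_def nodes_def
    by (auto simp: Y_def simp flip: of_nat_sum)
  have sumY: "(\<Sum>j\<in>q ` C. Y j v) = (\<Sum>c\<in>C. X c v)" for v
    unfolding Y_def using sum.image_gen[OF fin(1), of "\<lambda>c. X c v" q] by simp
  note outA = outflow_nodes[OF fin, of "\<lambda>u v. A u v - A v u" q
      "\<lambda>c v. int (X c v)" "\<lambda>j v. int (Y j v)", unfolded A_def, OF refl, folded A_def]
  have out: "outflow ?N (\<lambda>u v. A u v - A v u) u = int k * d u" if u: "u \<in> ?N" for u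
  proof (cases u)
    case (Cell c)
    then have "c \<in> C"
      using u by (auto simp: nodes_def)
    then show ?thesis
      using Cell outA(1) row by (simp add: d_def flip: of_nat_sum)
  next
    case (Slot j v)
    then have "j \<in> q ` C" "v \<in> V"
      using u by (auto simp: nodes_def)
    then show ?thesis
      using Slot outA(2) by (simp add: d_def Y_def)
  next
    case (Val v)
    then have "v \<in> V"
      using u by (auto simp: nodes_def)
    then show ?thesis
      using Val outA(3) wt sumY by (simp add: d_def flip: of_nat_sum)
  qed
  have "\<exists>g. flow cap g \<and> (\<forall>u\<in>?N. outflow ?N g u = d u)"
  proof (rule integral_flow[OF finite_nodes[OF fin], of "int k" cap "\<lambda>u v. A u v - A v u"])
    show "A u v - A v u \<le> int k * cap u v" if "u \<in> ?N" "v \<in> ?N" for u v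
      using A_cap[OF that] A0[of v u] by simp
  qed (use k cap0 out in auto)
  then obtain g where g: "flow cap g" and gd: "\<And>u. u \<in> ?N \<Longrightarrow> outflow ?N g u = d u"
    by blast
  define x where "x c v = g (Cell c) (Slot (q c) v)" for c v
  define y where "y j v = g (Slot j v) (Val v)" for j v
  have anti: "g u v = - g v u" and le: "g u v \<le> cap u v" for u v
    using flow_antisym[OF g] flow_le_cap[OF g] by blast+
  \<comment> \<open>Where the capacities vanish in both directions, so does \<open>g\<close>.\<close>
  have g_arcs: "g u v = arcs q x y u v - arcs q x y v u" for u v
    using anti[of u v] le[of u v] le[of v u]
    by (cases u; cases v) (auto simp: cap_def x_def y_def)
  note og = outflow_nodes[OF fin g_arcs]
  have x01: "0 \<le> x c v" "x c v \<le> of_bool (X c v > 0)" for c v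
    using le[of "Cell c" "Slot (q c) v"] le[of "Slot (q c) v" "Cell c"]
      anti[of "Cell c" "Slot (q c) v"] by (auto simp: cap_def x_def)
  have y1: "y j v \<le> 1" for j v
    using le[of "Slot j v" "Val v"] by (simp add: cap_def y_def)
  have xrow: "(\<Sum>v\<in>V. x c v) = 1" if "c \<in> C" for c
    using that og(1)[of c] gd[of "Cell c"] by (simp add: d_def nodes_def)
  have xcol: "(\<Sum>c\<in>{c \<in> C. q c = j}. x c v) = y j v" if "j \<in> q ` C" "v \<in> V" for j v
  proof -
    have "Slot j v \<in> ?N"
      using that by (auto simp: nodes_def)
    then show ?thesis
      using that og(2)[of j v] gd[of "Slot j v"] by (simp add: d_def)
  qed
  have xwt: "(\<Sum>c\<in>C. x c v) = int (n v)" if "v \<in> V" for v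
  proof -
    have "(\<Sum>c\<in>C. x c v) = (\<Sum>j\<in>q ` C. y j v)"
      using sum.image_gen[OF fin(1), of "\<lambda>c. x c v" q] xcol that by simp
    then show ?thesis
      using that og(3)[of v] gd[of "Val v"] by (simp add: d_def nodes_def)
  qed
  have "\<exists>v. v \<in> V \<and> x c v = 1 \<and> (\<forall>w\<in>V. x c w = 1 \<longrightarrow> w = v)" if c: "c \<in> C" for c
  proof -
    have "\<exists>v\<in>V. x c v \<noteq> 0"
      using xrow[OF c] sum.neutral[of V "x c"] by (metis zero_neq_one)
    then obtain v where v: "v \<in> V" "x c v = 1"
      using x01[of c] by (smt (verit) of_bool_less_eq_one)
    have "w = v" if "w \<in> V" "x c w = 1" for w
    proof (rule ccontr)
      assume "w \<noteq> v"
      then have "(\<Sum>v\<in>{v, w}. x c v) = 2"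
        using v that by simp
      moreover have "(\<Sum>v\<in>{v, w}. x c v) \<le> (\<Sum>v\<in>V. x c v)"
        using v that x01 fin by (intro sum_mono2) auto
      ultimately show False
        using xrow[OF c] by simp
    qed
    with v show ?thesis by blast
  qed
  then obtain f where f: "\<And>c. c \<in> C \<Longrightarrow> f c \<in> V" "\<And>c. c \<in> C \<Longrightarrow> x c (f c) = 1"
    "\<And>c w. c \<in> C \<Longrightarrow> w \<in> V \<Longrightarrow> x c w = 1 \<Longrightarrow> w = f c"
    by metis
  \<comment> \<open>The integral flow is the incidence function of the filling \<open>f\<close>.\<close>
  have xf: "x c v = of_bool (f c = v)" if "c \<in> C" "v \<in> V" for c v
    using f(2)[OF that(1)] f(3)[OF that] x01[of c v]
    by (cases "X c v > 0"; cases "f c = v"; cases "x c v = 0") auto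
  have "X c (f c) > 0" if "c \<in> C" for c
    using f(2)[OF that] x01(2)[of c "f c"] by (cases "X c (f c) > 0") auto
  moreover have "c = c'" if "c \<in> C" "c' \<in> C" "q c = q c'" "f c = f c'" for c c'
  proof (rule ccontr)
    assume "c \<noteq> c'"
    then have "2 = (\<Sum>b\<in>{c, c'}. x b (f c))"
      using f(2) that by force
    also have "\<dots> \<le> (\<Sum>b\<in>{b \<in> C. q b = q c}. x b (f c))"
      using that x01 fin by (intro sum_mono2) auto
    also have "\<dots> \<le> 1"
      using that f xcol y1 by simp
    finally show False by simp
  qed
  moreover have "card {c \<in> C. f c = v} = n v" if "v \<in> V" for v
    using xwt[OF that] xf that fin by (simp add: of_bool_def flip: sum.inter_filter)
  ultimately show ?thesis
    using f(1) by blast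
qed

section \<open>Straightening a filling into a tableau\<close>

lemma sorted_rearrangement:
  fixes key :: "'c \<Rightarrow> nat" and f :: "'c \<Rightarrow> nat"
  assumes "finite A" "inj_on key A"
  shows "\<exists>g. (\<forall>c\<in>A. \<forall>c'\<in>A. key c \<le> key c' \<longrightarrow> g c \<le> g c') \<and>
    image_mset g (mset_set A) = image_mset f (mset_set A)"
proof -
  obtain zs where zs: "set zs = A" "distinct zs"
    using finite_distinct_list[OF assms(1)] by blast
  define xs where "xs = sort_key key zs"
  have xs: "set xs = A" "distinct xs" "sorted (map key xs)"
    using zs by (auto simp: xs_def)
  define ys where "ys = sort (map f xs)"
  define g where "g = (\<lambda>c. the (map_of (zip xs ys) c))"
  have len: "length ys = length xs"
    by (simp add: ys_def)
  have g: "g (xs ! i) = ys ! i" if "i < length xs" for i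
    using that xs(2) len by (simp add: g_def map_of_zip_nth)
  then have map_g: "map g xs = ys"
    using len by (intro nth_equalityI) auto
  have "mset_set A = mset xs"
    using xs by (metis mset_set_set)
  then have "image_mset g (mset_set A) = image_mset f (mset_set A)"
    by (simp add: map_g ys_def flip: mset_map)
  moreover have "g c \<le> g c'" if c: "c \<in> A" "c' \<in> A" "key c \<le> key c'" for c c'
  proof -
    obtain i i' where i: "i < length xs" "c = xs ! i" "i' < length xs" "c' = xs ! i'"
      using c(1,2) unfolding xs(1)[symmetric] in_set_conv_nth by blast
    have "i \<le> i'"
    proof (rule ccontr)
      assume "\<not> i \<le> i'"
      then have "key c' \<le> key c" "c \<noteq> c'"
        using i xs sorted_nth_mono[OF xs(3), of i' i] by (auto simp: nth_eq_iff_index_eq)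
      then show False
        using c assms(2) by (auto dest: inj_onD)
    qed
    then show ?thesis
      using i g len by (simp add: ys_def sorted_nth_mono)
  qed
  ultimately show ?thesis by blast
qed

text \<open>
  Used both for columns (sorted by row index) and for rows (sorted by column index).  The
  counting form records that each fibre keeps its multiset of values.
\<close>

lemma sorted_rearrangement_in_fibres:
  fixes f key :: "'c \<Rightarrow> nat" and q :: "'c \<Rightarrow> 'j"
  assumes fin: "finite C"
    and inj: "\<And>c c'. c \<in> C \<Longrightarrow> c' \<in> C \<Longrightarrow> q c = q c' \<Longrightarrow> key c = key c' \<Longrightarrow> c = c'"
  shows "\<exists>g. (\<forall>c\<in>C. \<forall>c'\<in>C. q c = q c' \<longrightarrow> key c \<le> key c' \<longrightarrow> g c \<le> g c') \<and>
    (\<forall>j P. card {c \<in> C. q c = j \<and> P (g c)} = card {c \<in> C. q c = j \<and> P (f c)})"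
proof -
  have "\<forall>j. \<exists>h. (\<forall>c\<in>{c \<in> C. q c = j}. \<forall>c'\<in>{c \<in> C. q c = j}. key c \<le> key c' \<longrightarrow> h c \<le> h c') \<and>
    image_mset h (mset_set {c \<in> C. q c = j}) = image_mset f (mset_set {c \<in> C. q c = j})"
    using fin inj by (intro allI sorted_rearrangement) (auto simp: inj_on_def)
  from choice[OF this] obtain h where h:
    "\<forall>j. (\<forall>c\<in>{c \<in> C. q c = j}. \<forall>c'\<in>{c \<in> C. q c = j}. key c \<le> key c' \<longrightarrow> h j c \<le> h j c') \<and>
      image_mset (h j) (mset_set {c \<in> C. q c = j}) = image_mset f (mset_set {c \<in> C. q c = j})" ..
  have sz: "size (filter_mset P (image_mset h (mset_set {c \<in> C. q c = j}))) =
      card {c \<in> C. q c = j \<and> P (h c)}" for P j and h :: "'c \<Rightarrow> nat"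
    using fin by (auto simp: filter_mset_image_mset intro!: arg_cong[where f = card])
  have "card {c \<in> C. q c = j \<and> P (h (q c) c)} = card {c \<in> C. q c = j \<and> P (f c)}" for j P
  proof -
    have "{c \<in> C. q c = j \<and> P (h (q c) c)} = {c \<in> C. q c = j \<and> P (h j c)}"
      by auto
    then show ?thesis
      using sz[of P "h j" j] sz[of P f j] h[rule_format, of j] by simp
  qed
  then show ?thesis
    using h by (intro exI[of _ "\<lambda>c. h (q c) c"]) auto
qed

lemma card_filter_pos: "finite C \<Longrightarrow> c \<in> C \<Longrightarrow> P c \<Longrightarrow> card {c \<in> C. P c} > 0"
  by (auto simp: card_gt_0_iff)

lemma card_eq_if_fibres:
  assumes "finite C" "\<And>j. card {c \<in> C. q c = j \<and> P c} = card {c \<in> C. q c = j \<and> Q c}"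
  shows "card {c \<in> C. P c} = card {c \<in> C. Q c}"
proof -
  have *: "card {c \<in> C. P c} = (\<Sum>j\<in>q ` C. card {c \<in> C. q c = j \<and> P c})" for P
  proof -
    have "card {c \<in> C. P c} = (\<Sum>c\<in>C. of_bool (P c))"
      using assms(1) by (simp add: of_bool_def flip: sum.inter_filter)
    also have "\<dots> = (\<Sum>j\<in>q ` C. \<Sum>c\<in>{c \<in> C. q c = j}. of_bool (P c))"
      by (rule sum.image_gen[OF assms(1)])
    also have "\<dots> = (\<Sum>j\<in>q ` C. card {c \<in> C. q c = j \<and> P c})"
      using assms(1) by (simp add: of_bool_def Collect_conj_eq Int_assoc flip: sum.inter_filter)
    finally show ?thesis .
  qed
  show ?thesis
    by (simp only: *[of P] *[of Q] assms(2))
qed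

text \<open>
  If sorting a column put an entry above \<open>b ! i\<close> into row \<open>i\<close>, fewer entries would be at most
  \<open>b ! i\<close> than there are cells in rows up to \<open>i\<close>; but the original entries of all these cells
  are at most \<open>b ! i\<close>, since \<open>b\<close> increases.  The lower flag is symmetric.
\<close>

lemma column_strict_flagged_filling:
  fixes f :: "nat \<times> nat \<Rightarrow> nat"
  assumes ab: "length a = length lam" "length b = length lam" "sorted a" "sorted b"
    and flags: "\<And>i j. (i, j) \<in> cells lam mu \<Longrightarrow> f (i, j) \<in> {a ! i..b ! i}"
    and inj: "\<And>i i' j. (i, j) \<in> cells lam mu \<Longrightarrow> (i', j) \<in> cells lam mu \<Longrightarrow>
      f (i, j) = f (i', j) \<Longrightarrow> i = i'"
  shows "\<exists>g. (\<forall>i j. (i, j) \<in> cells lam mu \<longrightarrow> g (i, j) \<in> {a ! i..b ! i}) \<and>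
    (\<forall>i i' j. (i, j) \<in> cells lam mu \<longrightarrow> (i', j) \<in> cells lam mu \<longrightarrow> i < i' \<longrightarrow>
      g (i, j) < g (i', j)) \<and>
    (\<forall>v. card {c \<in> cells lam mu. g c = v} = card {c \<in> cells lam mu. f c = v})"
proof -
  let ?C = "cells lam mu"
  have fin: "finite ?C"
    by (rule finite_cells)
  have "\<exists>g. (\<forall>c\<in>?C. \<forall>c'\<in>?C. snd c = snd c' \<longrightarrow> fst c \<le> fst c' \<longrightarrow> g c \<le> g c') \<and>
    (\<forall>j P. card {c \<in> ?C. snd c = j \<and> P (g c)} = card {c \<in> ?C. snd c = j \<and> P (f c)})"
    by (rule sorted_rearrangement_in_fibres[OF fin]) (auto simp: prod_eq_iff)
  then obtain g where mono_g: "\<forall>c\<in>?C. \<forall>c'\<in>?C. snd c = snd c' \<longrightarrow> fst c \<le> fst c' \<longrightarrow> g c \<le> g c'"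
    and count: "\<And>j P. card {c \<in> ?C. snd c = j \<and> P (g c)} = card {c \<in> ?C. snd c = j \<and> P (f c)}"
    by blast
  have mono: "\<And>i i' j. (i, j) \<in> ?C \<Longrightarrow> (i', j) \<in> ?C \<Longrightarrow> i \<le> i' \<Longrightarrow> g (i, j) \<le> g (i', j)"
    using mono_g[rule_format] by fastforce
  have rows: "i < length lam" if "(i, j) \<in> ?C" for i j
    using that by (simp add: cells_def)
  have "g (i, j) \<le> b ! i" if ij: "(i, j) \<in> ?C" for i j
  proof (rule ccontr)
    assume less: "\<not> g (i, j) \<le> b ! i"
    let ?D = "{c \<in> ?C. snd c = j \<and> fst c \<le> i}"
    have "f c \<le> b ! i" if "c \<in> ?C" "fst c \<le> i" for c
      using flags[of "fst c" "snd c"] sorted_nth_mono[OF ab(4) that(2)] rows[OF ij] ab(2) that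
      by simp
    then have "card ?D \<le> card {c \<in> ?C. snd c = j \<and> f c \<le> b ! i}"
      using fin by (intro card_mono) auto
    then have ge: "card ?D \<le> card {c \<in> ?C. snd c = j \<and> g c \<le> b ! i}"
      using count[of j "\<lambda>x. x \<le> b ! i"] by simp
    have "{c \<in> ?C. snd c = j \<and> g c \<le> b ! i} \<subseteq> ?D - {(i, j)}"
      using mono[OF ij] less by (force simp: not_le)
    then have "card {c \<in> ?C. snd c = j \<and> g c \<le> b ! i} \<le> card (?D - {(i, j)})"
      using fin by (intro card_mono) auto
    also have "\<dots> < card ?D"
      using fin ij by (intro card_Diff1_less) auto
    finally show False
      using ge by simp
  qed
  moreover have "a ! i \<le> g (i, j)" if ij: "(i, j) \<in> ?C" for i j
  proof (rule ccontr)
    assume less: "\<not> a ! i \<le> g (i, j)"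
    let ?D = "{c \<in> ?C. snd c = j \<and> i \<le> fst c}"
    have "a ! i \<le> f c" if "c \<in> ?C" "i \<le> fst c" for c
      using flags[of "fst c" "snd c"] sorted_nth_mono[OF ab(3) that(2)] rows[of "fst c" "snd c"]
        ab(1) that by simp
    then have "card ?D \<le> card {c \<in> ?C. snd c = j \<and> a ! i \<le> f c}"
      using fin by (intro card_mono) auto
    then have ge: "card ?D \<le> card {c \<in> ?C. snd c = j \<and> a ! i \<le> g c}"
      using count[of j "\<lambda>x. a ! i \<le> x"] by simp
    have "{c \<in> ?C. snd c = j \<and> a ! i \<le> g c} \<subseteq> ?D - {(i, j)}"
      using mono[OF _ ij] less by (force simp: not_le)
    then have "card {c \<in> ?C. snd c = j \<and> a ! i \<le> g c} \<le> card (?D - {(i, j)})"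
      using fin by (intro card_mono) auto
    also have "\<dots> < card ?D"
      using fin ij by (intro card_Diff1_less) auto
    finally show False
      using ge by simp
  qed
  moreover have "g (i, j) < g (i', j)" if ij: "(i, j) \<in> ?C" "(i', j) \<in> ?C" "i < i'" for i i' j
  proof (rule ccontr)
    assume "\<not> g (i, j) < g (i', j)"
    then have eq: "g (i', j) = g (i, j)"
      using mono[OF ij(1,2)] ij(3) by simp
    have "2 = card {(i, j), (i', j)}"
      using ij by simp
    also have "\<dots> \<le> card {c \<in> ?C. snd c = j \<and> g c = g (i, j)}"
      using fin ij eq by (intro card_mono) auto
    also have "\<dots> = card {c \<in> ?C. snd c = j \<and> f c = g (i, j)}"
      using count[of j "\<lambda>x. x = g (i, j)"] .
    also have "\<dots> \<le> 1"
      using fin inj by (subst One_nat_def, subst card_le_Suc0_iff_eq) auto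
    finally show False by simp
  qed
  moreover have "card {c \<in> ?C. g c = v} = card {c \<in> ?C. f c = v}" for v
    by (rule card_eq_if_fibres[OF fin, of snd]) (rule count[of _ "\<lambda>x. x = v"])
  ultimately show ?thesis
    by (intro exI[of _ g]) auto
qed

text \<open>
  Why columns stay strict: let \<open>i < i'\<close> and let \<open>v\<close> be the sorted entry at
  \<open>(i', j)\<close>.  Row \<open>i'\<close> then has at
  least \<open>j + 1 - mu ! i'\<close> entries up to \<open>v\<close>.  At most \<open>mu ! i - mu ! i'\<close> of them lie to
  the left of the first cell of row \<open>i\<close>; before sorting, each of the others had an entry below \<open>v\<close> above it
  in row \<open>i\<close>.  So row \<open>i\<close> has at least \<open>j + 1 - mu ! i\<close> entries below \<open>v\<close>, and these
  reach column \<open>j\<close> when sorted.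
\<close>

lemma sort_rows_of_column_strict_filling:
  fixes g :: "nat \<times> nat \<Rightarrow> nat"
  assumes shape: "skew_shape lam mu"
    and pos: "\<And>c. c \<in> cells lam mu \<Longrightarrow> g c > 0"
    and flags: "\<And>i j. (i, j) \<in> cells lam mu \<Longrightarrow> g (i, j) \<in> {a ! i..b ! i}"
    and strict: "\<And>i i' j. (i, j) \<in> cells lam mu \<Longrightarrow> (i', j) \<in> cells lam mu \<Longrightarrow> i < i' \<Longrightarrow>
      g (i, j) < g (i', j)"
  shows "\<exists>T\<in>flagged_ssyt lam mu a b.
    \<forall>v. card {c \<in> cells lam mu. T c = v} = card {c \<in> cells lam mu. g c = v}"
proof -
  let ?C = "cells lam mu"
  have fin: "finite ?C"
    by (rule finite_cells)
  have "\<exists>h. (\<forall>c\<in>?C. \<forall>c'\<in>?C. fst c = fst c' \<longrightarrow> snd c \<le> snd c' \<longrightarrow> h c \<le> h c') \<and>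
    (\<forall>i P. card {c \<in> ?C. fst c = i \<and> P (h c)} = card {c \<in> ?C. fst c = i \<and> P (g c)})"
    by (rule sorted_rearrangement_in_fibres[OF fin]) (auto simp: prod_eq_iff)
  then obtain h where mono_h: "\<forall>c\<in>?C. \<forall>c'\<in>?C. fst c = fst c' \<longrightarrow> snd c \<le> snd c' \<longrightarrow> h c \<le> h c'"
    and count: "\<And>i P. card {c \<in> ?C. fst c = i \<and> P (h c)} = card {c \<in> ?C. fst c = i \<and> P (g c)}"
    by blast
  have mono: "\<And>i j j'. (i, j) \<in> ?C \<Longrightarrow> (i, j') \<in> ?C \<Longrightarrow> j \<le> j' \<Longrightarrow> h (i, j) \<le> h (i, j')"
    using mono_h[rule_format] by fastforce
  have from_g: "\<exists>j'. (i, j') \<in> ?C \<and> g (i, j') = h (i, j)" if "(i, j) \<in> ?C" for i j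
  proof -
    have "card {c \<in> ?C. fst c = i \<and> h c = h (i, j)} > 0"
      using that by (intro card_filter_pos[OF fin]) auto
    then have "{c \<in> ?C. fst c = i \<and> g c = h (i, j)} \<noteq> {}"
      unfolding count[of i "\<lambda>x. x = h (i, j)"] by (metis card.empty less_irrefl)
    then show ?thesis by auto
  qed
  have h_strict: "h (i, j) < h (i', j)" if ij: "(i, j) \<in> ?C" "(i', j) \<in> ?C" "i < i'" for i i' j
  proof (rule ccontr)
    define v where "v = h (i', j)"
    assume "\<not> h (i, j) < h (i', j)"
    then have v: "v \<le> h (i, j)"
      by (simp add: v_def)
    have le: "mu ! i' \<le> mu ! i" "lam ! i' \<le> lam ! i" "mu ! i \<le> j"
      using shape ij by (auto simp: skew_shape_def cells_def sorted_wrt_iff_nth_less)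
    let ?B = "{c \<in> ?C. fst c = i \<and> g c < v}"
    have "card ?B = card {c \<in> ?C. fst c = i \<and> h c < v}"
      using count[of i "\<lambda>x. x < v"] by simp
    also have "\<dots> \<le> card (Pair i ` {mu ! i..<j})"
    proof (rule card_mono)
      show "{c \<in> ?C. fst c = i \<and> h c < v} \<subseteq> Pair i ` {mu ! i..<j}"
      proof
        fix c assume "c \<in> {c \<in> ?C. fst c = i \<and> h c < v}"
        then obtain m where c: "c = (i, m)" and m: "(i, m) \<in> ?C" "h (i, m) < v"
          by (cases c) auto
        then have "m < j"
          using mono[OF ij(1) m(1)] v by (metis leD le_trans not_le)
        then show "c \<in> Pair i ` {mu ! i..<j}"
          using c m(1) by (auto simp: cells_def)
      qed
    qed simp
    also have "\<dots> = j - mu ! i"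
      by (simp add: card_image inj_on_def)
    finally have card_B: "card ?B \<le> j - mu ! i" .
    have "card (Pair i' ` {mu ! i'..j}) \<le> card {c \<in> ?C. fst c = i' \<and> h c \<le> v}"
      using fin ij(2) mono[of i' _ j] by (intro card_mono) (auto simp: cells_def v_def)
    also have "\<dots> = card {c \<in> ?C. fst c = i' \<and> g c \<le> v}"
      using count[of i' "\<lambda>x. x \<le> v"] .
    also have "\<dots> \<le> card (Pair i' ` {mu ! i'..<mu ! i} \<union> (\<lambda>c. (i', snd c)) ` ?B)"
    proof (rule card_mono)
      show "{c \<in> ?C. fst c = i' \<and> g c \<le> v} \<subseteq>
          Pair i' ` {mu ! i'..<mu ! i} \<union> (\<lambda>c. (i', snd c)) ` ?B"
      proof (rule subsetI, rule ccontr)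
        fix c
        assume "c \<in> {c \<in> ?C. fst c = i' \<and> g c \<le> v}"
          and c: "c \<notin> Pair i' ` {mu ! i'..<mu ! i} \<union> (\<lambda>c. (i', snd c)) ` ?B"
        then obtain m where m: "c = (i', m)" "(i', m) \<in> ?C" "g (i', m) \<le> v"
          by (cases c) auto
        have "m < mu ! i"
        proof (rule ccontr)
          assume "\<not> m < mu ! i"
          then have "(i, m) \<in> ?C"
            using m(2) ij le by (auto simp: cells_def)
          then have "(i, m) \<in> ?B"
            using strict[OF _ m(2) ij(3)] m(3) by simp
          then show False
            using c m(1) by force
        qed
        then show False
          using c m(1,2) by (auto simp: cells_def)
      qed
    qed (use fin in simp)
    also have "\<dots> \<le> card (Pair i' ` {mu ! i'..<mu ! i}) + card ((\<lambda>c. (i', snd c)) ` ?B)"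
      by (rule card_Un_le)
    also have "\<dots> \<le> (mu ! i - mu ! i') + card ?B"
      using fin by (intro add_mono card_image_le) (auto simp: card_image inj_on_def)
    finally show False
      using le card_B by (simp add: card_image inj_on_def)
  qed
  define T where "T = restrict h ?C"
  have T: "T c = h c" if "c \<in> ?C" for c
    using that by (simp add: T_def)
  have "T \<in> ssyt lam mu"
    unfolding ssyt_def
  proof (intro CollectI conjI ballI allI impI)
    show "T \<in> extensional ?C"
      by (simp add: T_def)
    show "T c > 0" if "c \<in> ?C" for c
      using from_g[of "fst c" "snd c"] pos that T by (metis prod.collapse)
  qed (use T mono h_strict in auto)
  moreover have "T (i, j) \<in> {a ! i..b ! i}" if "(i, j) \<in> ?C" for i j
    using from_g[OF that] flags T[OF that] by metis
  ultimately have "T \<in> flagged_ssyt lam mu a b"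
    by (auto simp: flagged_ssyt_def)
  moreover have "card {c \<in> ?C. T c = v} = card {c \<in> ?C. g c = v}" for v
  proof -
    have "{c \<in> ?C. T c = v} = {c \<in> ?C. h c = v}"
      using T by auto
    then show ?thesis
      using card_eq_if_fibres[OF fin, of fst "\<lambda>c. h c = v" "\<lambda>c. g c = v"]
        count[of _ "\<lambda>x. x = v"] by simp
  qed
  ultimately show ?thesis by blast
qed

section \<open>Saturation\<close>

text \<open>
  Scaling replaces the column \<open>j\<close> by the columns \<open>k * j + r\<close> with \<open>r < k\<close>.
\<close>

lemma scaled_cells_iff:
  assumes "length mu = length lam" "k > 0"
  shows "(i, j) \<in> cells (scale k lam) (scale k mu) \<longleftrightarrow> (i, j div k) \<in> cells lam mu"
proof -
  have "k * m \<le> j \<longleftrightarrow> m \<le> j div k" "j < k * m \<longleftrightarrow> j div k < m" for m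
    using assms(2) by (simp_all add: less_eq_div_iff_mult_less_eq div_less_iff_less_mult mult.commute)
  then show ?thesis
    using assms(1) by (auto simp: cells_def scale_def)
qed

lemma sum_scaled_cells:
  fixes h :: "nat \<times> nat \<Rightarrow> nat"
  assumes "length mu = length lam" "k > 0"
  shows "sum h (cells (scale k lam) (scale k mu)) =
    (\<Sum>c\<in>cells lam mu. \<Sum>r<k. h (fst c, k * snd c + r))"
proof -
  have "(\<Sum>c\<in>cells lam mu. \<Sum>r<k. h (fst c, k * snd c + r)) =
      (\<Sum>(c, r)\<in>cells lam mu \<times> {..<k}. h (fst c, k * snd c + r))"
    by (rule sum.cartesian_product)
  also have "\<dots> = sum h (cells (scale k lam) (scale k mu))"
    by (rule sum.reindex_bij_witness[of _ "\<lambda>(i, j). ((i, j div k), j mod k)"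
          "\<lambda>(c, r). (fst c, k * snd c + r)"])
      (use assms in \<open>auto simp: scaled_cells_iff\<close>)
  finally show ?thesis by simp
qed

theorem theorem28:
  fixes lam mu a b nu :: "nat list" and l k :: nat
  assumes "skew_shape lam mu"
    and "length lam = l"
    and "length a = l" and "sorted a"
    and "length b = l" and "sorted b"
    and "k \<ge> 1"
    and "flagged_kostka (scale k lam) (scale k mu) (scale k nu) a b > 0"
  shows "flagged_kostka lam mu nu a b > 0"
proof -
  let ?C = "cells lam mu" and ?Ck = "cells (scale k lam) (scale k mu)"
  define V where "V = {1..length nu}"
  have k: "k > 0" and len: "length mu = length lam"
    using assms by (auto simp: skew_shape_def)
  obtain T where T: "T \<in> flagged_ssyt (scale k lam) (scale k mu) a b"
    and wt: "has_weight (scale k lam) (scale k mu) T (scale k nu)"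
    using assms(8) unfolding flagged_kostka_def card_gt_0_iff by blast
  have cell: "(i, k * j + r) \<in> ?Ck" if "(i, j) \<in> ?C" "r < k" for i j r
    using that scaled_cells_iff[OF len k] k by simp
  have TV: "T c \<in> V" if c: "c \<in> ?Ck" for c
  proof -
    have pos: "T c \<ge> 1"
      using T c by (auto simp: flagged_ssyt_def ssyt_def Suc_le_eq)
    have "card {c' \<in> ?Ck. T c' = T c} > 0"
      using c by (intro card_filter_pos finite_cells) auto
    then show ?thesis
      using wt pos by (auto simp: has_weight_def V_def scale_def split: if_splits)
  qed
  \<comment> \<open>The multiplicity of the value \<open>v\<close> among the \<open>k\<close> cells of the scaled shape lying over \<open>c\<close>.\<close>
  define X where "X c v = (\<Sum>r<k. of_bool (T (fst c, k * snd c + r) = v) :: nat)" for c v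
  have "\<exists>f. (\<forall>c\<in>?C. f c \<in> V \<and> X c (f c) > 0) \<and>
    (\<forall>c\<in>?C. \<forall>c'\<in>?C. snd c = snd c' \<longrightarrow> f c = f c' \<longrightarrow> c = c') \<and>
    (\<forall>v\<in>V. card {c \<in> ?C. f c = v} = nu ! (v - 1))"
  proof (rule round_fractional_filling[OF finite_cells _ k])
    show "finite V"
      by (simp add: V_def)
    show "(\<Sum>v\<in>V. X c v) = k" if "c \<in> ?C" for c
    proof -
      have "(\<Sum>v\<in>V. X c v) = (\<Sum>r<k. \<Sum>v\<in>V. of_bool (T (fst c, k * snd c + r) = v))"
        unfolding X_def by (rule sum.swap)
      also have "\<dots> = (\<Sum>r<k. 1)"
        using TV[OF cell[of "fst c" "snd c"]] that
        by (intro sum.cong refl) (simp add: of_bool_def V_def)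
      finally show ?thesis by simp
    qed
    show "(\<Sum>c\<in>{c \<in> ?C. snd c = j}. X c v) \<le> k" for j v
    proof -
      have "(\<Sum>c\<in>{c \<in> ?C. snd c = j}. X c v) =
          (\<Sum>r<k. card {c \<in> ?C. snd c = j \<and> T (fst c, k * j + r) = v})"
        unfolding X_def using finite_cells
        by (subst sum.swap) (simp add: of_bool_def conj_assoc flip: sum.inter_filter)
      also have "\<dots> \<le> (\<Sum>r<k. 1)"
      proof (rule sum_mono)
        fix r assume r: "r \<in> {..<k}"
        have "i = i'" if "(i, j) \<in> ?C" "(i', j) \<in> ?C" "T (i, k * j + r) = T (i', k * j + r)" for i i'
          using T cell[OF that(1)] cell[OF that(2)] r that(3)
          by (cases i i' rule: linorder_cases) (fastforce simp: flagged_ssyt_def ssyt_def)+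
        then show "card {c \<in> ?C. snd c = j \<and> T (fst c, k * j + r) = v} \<le> 1"
          using finite_cells by (subst One_nat_def, subst card_le_Suc0_iff_eq) auto
      qed
      finally show ?thesis by simp
    qed
    show "(\<Sum>c\<in>?C. X c v) = k * nu ! (v - 1)" if "v \<in> V" for v
    proof -
      have "(\<Sum>c\<in>?C. X c v) = card {c \<in> ?Ck. T c = v}"
        unfolding X_def sum_scaled_cells[OF len k, of "\<lambda>c. of_bool (T c = v)", symmetric]
        using finite_cells by (simp add: of_bool_def flip: sum.inter_filter)
      then show ?thesis
        using wt that by (auto simp: has_weight_def V_def scale_def)
    qed
  qed
  then obtain f where f: "\<And>c. c \<in> ?C \<Longrightarrow> f c \<in> V" "\<And>c. c \<in> ?C \<Longrightarrow> X c (f c) > 0"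
    and inj: "\<And>c c'. c \<in> ?C \<Longrightarrow> c' \<in> ?C \<Longrightarrow> snd c = snd c' \<Longrightarrow> f c = f c' \<Longrightarrow> c = c'"
    and f_wt: "\<And>v. v \<in> V \<Longrightarrow> card {c \<in> ?C. f c = v} = nu ! (v - 1)"
    by blast
  have "f (i, j) \<in> {a ! i..b ! i}" if ij: "(i, j) \<in> ?C" for i j
  proof -
    obtain r where "r < k" "T (i, k * j + r) = f (i, j)"
      using f(2)[OF ij] by (auto simp: X_def simp del: sum_of_bool_eq
          elim!: sum.not_neutral_contains_not_neutral[OF gr_implies_not0])
    then show ?thesis
      using cell[OF ij] T by (force simp: flagged_ssyt_def)
  qed
  moreover have "i = i'" if "(i, j) \<in> ?C" "(i', j) \<in> ?C" "f (i, j) = f (i', j)" for i i' j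
    using inj[OF that(1,2)] that(3) by simp
  ultimately obtain g where
    g_flags: "\<And>i j. (i, j) \<in> ?C \<Longrightarrow> g (i, j) \<in> {a ! i..b ! i}"
    and g_strict: "\<And>i i' j. (i, j) \<in> ?C \<Longrightarrow> (i', j) \<in> ?C \<Longrightarrow> i < i' \<Longrightarrow> g (i, j) < g (i', j)"
    and g_wt: "\<And>v. card {c \<in> ?C. g c = v} = card {c \<in> ?C. f c = v}"
    using column_strict_flagged_filling[of a lam b mu f] assms(2-6) by auto
  have g_pos: "g c > 0" if "c \<in> ?C" for c
  proof -
    have "card {c' \<in> ?C. g c' = g c} > 0"
      using that by (intro card_filter_pos finite_cells) auto
    then have "{c' \<in> ?C. f c' = g c} \<noteq> {}"
      unfolding g_wt by (metis card.empty less_irrefl)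
    then show ?thesis
      using f(1) by (force simp: V_def)
  qed
  obtain S where S: "S \<in> flagged_ssyt lam mu a b"
    and S_wt: "\<And>v. card {c \<in> ?C. S c = v} = card {c \<in> ?C. g c = v}"
    using sort_rows_of_column_strict_filling[of lam mu g a b] assms(1) g_pos g_flags g_strict
    by blast
  have "has_weight lam mu S nu"
    unfolding has_weight_def
  proof (intro allI impI)
    fix v :: nat assume v: "v \<ge> 1"
    show "card {c \<in> ?C. S c = v} = (if v \<le> length nu then nu ! (v - 1) else 0)"
    proof (cases "v \<in> V")
      case True
      then show ?thesis
        using S_wt g_wt f_wt by (simp add: V_def)
    next
      case False
      then have "card {c \<in> ?C. f c = v} = 0"
        using f(1) by (metis (mono_tags, lifting) card.empty empty_Collect_eq)
      then show ?thesis
        using S_wt g_wt False v by (simp add: V_def)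
    qed
  qed
  with S show ?thesis
    unfolding flagged_kostka_def card_gt_0_iff using finite_flagged_ssyt[of lam mu a b] by auto
qed

end
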